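(* The projective plane $\mathbb{P}^2$ is covered by one degree $8$ pseudo-chart with finite fibers; that is, there is a surjective morphism $f:\mathbb{A}^2\to\mathbb{P}^2$ of degree $8$ with finite fibers.
   Context: All varieties are over the complex field $\mathbb{C}$ (or, equivalently, over any algebraically closed field of characteristic zero). Let $X$ be an integral rational quasi-projective variety of dimension $n$. A pseudo-chart of $X$ is a morphism $f: \mathbb{A}^n\to X$ such that $\dim f(\mathbb{A}^n) = n$; it is a pseudo-chart with finite fibers if all fibers of $f$ are finite. Its degree is the degree of $f$ as a generically finite dominant morphism, i.e. the degree of the induced extension of function fields. $X$ is covered by a set of pseudo-charts if the union of their images is $X$. *)

theory Defs
  imports
    "HOL-Analysis.Analysis"
    "HOL-Algebra.Algebraic_Closure_Type"
begin

type_synonym A2 = "complex^2"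

definition scalar_equiv :: "complex^3 \<Rightarrow> complex^3 \<Rightarrow> bool" where
  "scalar_equiv v w \<longleftrightarrow> v \<noteq> 0 \<and> w \<noteq> 0 \<and> (\<exists>c. w = c *s v)"

text \<open>The relation is partial: it is reflexive exactly on the nonzero vectors. Hence
  \<open>abs_P2 v\<close> is the point with homogeneous coordinates \<open>v\<close> only for \<open>v \<noteq> 0\<close>.\<close>

quotient_type P2 = "complex^3" / partial: scalar_equiv
proof (rule part_equivpI)
  have "scalar_equiv 1 1"
    unfolding scalar_equiv_def by (auto intro!: exI[of _ 1])
  then show "\<exists>v. scalar_equiv v v" by blast
next
  show "symp scalar_equiv"
  proof (rule sympI)
    fix v w assume "scalar_equiv v w"
    then obtain c where c: "v \<noteq> 0" "w \<noteq> 0" "w = c *s v"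
      unfolding scalar_equiv_def by blast
    then have "c \<noteq> 0" by auto
    with c(3) have "v = inverse c *s w" by (simp add: vector_smult_assoc)
    with c(1,2) show "scalar_equiv w v" unfolding scalar_equiv_def by blast
  qed
next
  show "transp scalar_equiv"
    by (rule transpI) (auto simp: scalar_equiv_def vector_smult_assoc)
qed

text \<open>\<open>complex poly poly\<close> is \<open>\<complex>[x\<^sub>1][x\<^sub>2]\<close> and \<open>complex poly poly poly\<close> is
  \<open>\<complex>[x\<^sub>1][x\<^sub>2][x\<^sub>3]\<close>: the outermost variable is the last coordinate.\<close>

definition eval2 :: "complex poly poly \<Rightarrow> A2 \<Rightarrow> complex" where
  "eval2 p v = poly (poly p [:v $ 2:]) (v $ 1)"

definition eval3 :: "complex poly poly poly \<Rightarrow> complex^3 \<Rightarrow> complex" where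
  "eval3 p v = poly (poly (poly p [:[:v $ 3:]:]) [:v $ 2:]) (v $ 1)"

definition homogeneous :: "nat \<Rightarrow> complex poly poly poly \<Rightarrow> bool" where
  "homogeneous d p \<longleftrightarrow>
     (\<forall>i j k. Polynomial.coeff (Polynomial.coeff (Polynomial.coeff p k) j) i \<noteq> 0 \<longrightarrow> i + j + k = d)"

definition zariski_open_A2 :: "A2 set \<Rightarrow> bool" where
  "zariski_open_A2 U \<longleftrightarrow> (\<exists>T. - U = {v. \<forall>p\<in>T. eval2 p v = 0})"

definition zariski_open_P2 :: "P2 set \<Rightarrow> bool" where
  "zariski_open_P2 U \<longleftrightarrow>
     (\<exists>T. (\<forall>p\<in>T. \<exists>d. homogeneous d p) \<and>
          - U = {abs_P2 v | v. v \<noteq> 0 \<and> (\<forall>p\<in>T. eval3 p v = 0)})"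

definition regular_on_A2 :: "A2 set \<Rightarrow> (A2 \<Rightarrow> complex) \<Rightarrow> bool" where
  "regular_on_A2 U r \<longleftrightarrow>
     (\<forall>u\<in>U. \<exists>W g h. zariski_open_A2 W \<and> u \<in> W \<and> W \<subseteq> U \<and>
        (\<forall>v\<in>W. eval2 h v \<noteq> 0 \<and> r v = eval2 g v / eval2 h v))"

definition regular_on_P2 :: "P2 set \<Rightarrow> (P2 \<Rightarrow> complex) \<Rightarrow> bool" where
  "regular_on_P2 U r \<longleftrightarrow>
     (\<forall>a\<in>U. \<exists>W d g h. zariski_open_P2 W \<and> a \<in> W \<and> W \<subseteq> U \<and>
        homogeneous d g \<and> homogeneous d h \<and>
        (\<forall>v. v \<noteq> 0 \<and> abs_P2 v \<in> W \<longrightarrow>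
             eval3 h v \<noteq> 0 \<and> r (abs_P2 v) = eval3 g v / eval3 h v))"

definition morphism_A2_P2 :: "(A2 \<Rightarrow> P2) \<Rightarrow> bool" where
  "morphism_A2_P2 f \<longleftrightarrow>
     (\<forall>U. zariski_open_P2 U \<longrightarrow> zariski_open_A2 (f -` U)) \<and>
     (\<forall>U r. zariski_open_P2 U \<and> regular_on_P2 U r \<longrightarrow> regular_on_A2 (f -` U) (r \<circ> f))"

text \<open>The function field of \<open>A2\<close> is the whole type \<open>complex poly poly fract\<close>; that of \<open>P2\<close>
  is the degree-zero part of the homogeneous localisation of \<open>\<complex>[x\<^sub>1, x\<^sub>2, x\<^sub>3]\<close>.\<close>

definition function_field_P2 :: "complex poly poly poly fract set" where
  "function_field_P2 =
     {Fraction_Field.Fract g h | g h d. homogeneous d g \<and> homogeneous d h \<and> h \<noteq> 0}"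

text \<open>\<open>has_value_A2 b v c\<close>: the rational function \<open>b\<close> is regular at \<open>v\<close> with value \<open>c\<close>.\<close>

definition has_value_A2 :: "complex poly poly fract \<Rightarrow> A2 \<Rightarrow> complex \<Rightarrow> bool" where
  "has_value_A2 b v c \<longleftrightarrow>
     (\<exists>g h. b = Fraction_Field.Fract g h \<and> eval2 h v \<noteq> 0 \<and> c = eval2 g v / eval2 h v)"

definition has_value_P2 :: "complex poly poly poly fract \<Rightarrow> P2 \<Rightarrow> complex \<Rightarrow> bool" where
  "has_value_P2 a x c \<longleftrightarrow>
     (\<exists>g h d v. a = Fraction_Field.Fract g h \<and> homogeneous d g \<and> homogeneous d h \<and>
        v \<noteq> 0 \<and> x = abs_P2 v \<and> eval3 h v \<noteq> 0 \<and> c = eval3 g v / eval3 h v)"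

text \<open>\<open>is_pullback f a b\<close>: on a nonempty open set, \<open>b\<close> is the composition of \<open>a\<close> with \<open>f\<close>.
  For dominant \<open>f\<close> this is the graph of the field embedding
  \<open>f\<^sup>* : \<complex>(P2) \<rightarrow> \<complex>(A2)\<close>.\<close>

definition is_pullback ::
    "(A2 \<Rightarrow> P2) \<Rightarrow> complex poly poly poly fract \<Rightarrow> complex poly poly fract \<Rightarrow> bool" where
  "is_pullback f a b \<longleftrightarrow>
     (\<exists>U. zariski_open_A2 U \<and> U \<noteq> {} \<and>
          (\<forall>v\<in>U. \<exists>c. has_value_P2 a (f v) c \<and> has_value_A2 b v c))"

definition pullback_field :: "(A2 \<Rightarrow> P2) \<Rightarrow> complex poly poly fract set" where
  "pullback_field f = {b. \<exists>a\<in>function_field_P2. is_pullback f a b}"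

text \<open>The degree of the field extension of \<open>\<complex>(A2)\<close> over \<open>f\<^sup>* \<complex>(P2)\<close>. The library predicate
  \<open>ring.dimension n K E\<close> expresses \<open>dim\<^sub>K E = n\<close> only when \<open>K\<close> is a subfield.\<close>

definition has_degree :: "(A2 \<Rightarrow> P2) \<Rightarrow> nat \<Rightarrow> bool" where
  "has_degree f n \<longleftrightarrow>
     (let R = (ring_of_type_algebra :: complex poly poly fract ring)
      in subfield (pullback_field f) R \<and>
         ring.dimension R n (pullback_field f) (carrier R))"

end

theory Submission
  imports Defs
begin

(* Keeps the component notation of vectors unambiguous. *)
unbundle no fps_syntax

text \<open>
  The map \<open>x \<mapsto> [x\<^sup>2 + 1 : x]\<close>, that is \<open>x + 1/x\<close>, sends the affine line onto the
  projective line with degree two: its only preimages of \<open>\<infinity>\<close> on the projective line are \<open>\<infinity>\<close>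
  and \<open>0\<close>, so removing \<open>\<infinity>\<close> from the source loses no value. Two copies of it map the affine
  plane onto the product of two projective lines with degree four. Multiplication of binary
  linear forms, \<open>([a:c], [b:d]) \<mapsto> [ab : ad + bc : cd]\<close>, maps that product onto the projective
  plane of binary quadratic forms with degree two, because a nonzero binary quadratic form over
  the complex numbers has exactly one factorisation up to order and scalars. The composite
  \<open>(x, y) \<mapsto> [(x\<^sup>2 + 1)(y\<^sup>2 + 1) : (x\<^sup>2 + 1) y + x (y\<^sup>2 + 1) : x y]\<close>
  is therefore surjective with finite fibres (\<open>surj_cover\<close>, \<open>finite_fibre\<close>) and has degree
  \<open>2 \<cdot> 2 \<cdot> 2\<close>.

  For the degree, let \<open>K\<close> be the pulled back function field, \<open>u = x + 1/x\<close> and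
  \<open>w = y + 1/y\<close>. Then \<open>K\<close> contains \<open>u + w\<close> and \<open>u w\<close>, so in the tower
  \<open>K \<subseteq> K(u) \<subseteq> K(u, x) \<subseteq> K(u, x, y)\<close> each new element is a root of a monic quadratic
  polynomial over the preceding field: \<open>u\<^sup>2 = (u + w) u - u w\<close>, \<open>x\<^sup>2 = u x - 1\<close> and
  \<open>y\<^sup>2 = w y - 1\<close>. The top field contains the constants and both coordinates, hence is
  everything. Each step has degree exactly two (\<open>quadratic_extension\<close>) because a symmetry of the
  map fixes the lower field but not the new element: the exchange of \<open>x\<close> and \<open>y\<close> moves \<open>u\<close>,
  inversion of \<open>x\<close> fixes \<open>u\<close> and moves \<open>x\<close>, inversion of \<open>y\<close> fixes \<open>u\<close> and \<open>x\<close> and moves \<open>y\<close>.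

  The symmetries act on points only, and a rational function counts as fixed if it takes equal
  values at a generic point and at its image (\<open>invariant\<close>). Elements of \<open>K\<close> are fixed since they
  are constant on generic fibres (\<open>pullback_field_constant_on_fibres\<close>). That in turn comes from
  the description of \<open>K\<close> as the fractions obtained by substituting the three polynomials into
  homogeneous fractions (\<open>pullback_field_eq\<close>), where surjectivity guarantees that no nonzero
  denominator becomes zero (\<open>subst_lift_nonzero\<close>).
\<close>

section \<open>Evaluation of polynomials\<close>

lemma eval2_simps [simp]:
  "eval2 0 v = 0" "eval2 1 v = 1"
  "eval2 (p + q) v = eval2 p v + eval2 q v"
  "eval2 (p - q) v = eval2 p v - eval2 q v"
  "eval2 (- p) v = - eval2 p v"
  "eval2 (p * q) v = eval2 p v * eval2 q v"
  "eval2 (p ^ n) v = eval2 p v ^ n"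
  "eval2 [:[:c:]:] v = c"
  "eval2 [:[:0, 1:]:] v = v $ 1"
  "eval2 [:0, 1:] v = v $ 2"
  by (simp_all add: eval2_def)

lemma eval3_simps [simp]:
  "eval3 0 v = 0" "eval3 1 v = 1"
  "eval3 (p + q) v = eval3 p v + eval3 q v"
  "eval3 (p - q) v = eval3 p v - eval3 q v"
  "eval3 (- p) v = - eval3 p v"
  "eval3 (p * q) v = eval3 p v * eval3 q v"
  "eval3 [:[:[:c:]:]:] v = c"
  "eval3 [:[:[:0, 1:]:]:] v = v $ 1"
  "eval3 [:[:0, 1:]:] v = v $ 2"
  "eval3 [:0, 1:] v = v $ 3"
  by (simp_all add: eval3_def)

lemma poly_eq_0_if_roots_inj:
  fixes f :: "complex \<Rightarrow> 'a :: idom"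
  assumes "inj f" "\<And>b. poly p (f b) = 0"
  shows "p = 0"
proof (rule ccontr)
  assume "p \<noteq> 0"
  then have "finite {x. poly p x = 0}" by (rule poly_roots_finite)
  moreover have "range f \<subseteq> {x. poly p x = 0}" using assms(2) by auto
  ultimately have "finite (range f)" by (rule finite_subset[rotated])
  then have "finite (UNIV :: complex set)" using assms(1) by (rule finite_imageD)
  then show False using infinite_UNIV_char_0 by blast
qed

lemma eval2_eq_0_imp:
  assumes "\<And>v. eval2 p v = 0"
  shows "p = 0"
proof (rule poly_eq_0_if_roots_inj[of "\<lambda>b. [:b:]"])
  fix b
  have "poly (poly p [:b:]) a = 0" for a
    using assms[of "vector [a, b]"] by (simp add: eval2_def)
  then show "poly p [:b:] = 0" using poly_all_0_iff_0 by blast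
qed (simp add: inj_on_def)

lemma eval2_inject:
  assumes "\<And>v. eval2 p v = eval2 q v"
  shows "p = q"
  using eval2_eq_0_imp[of "p - q"] assms by simp

lemma eval3_eq_0_imp:
  assumes "\<And>v. eval3 p v = 0"
  shows "p = 0"
proof (rule poly_eq_0_if_roots_inj[of "\<lambda>c. [:[:c:]:]"])
  fix c
  show "poly p [:[:c:]:] = 0"
  proof (rule eval2_eq_0_imp)
    fix v
    show "eval2 (poly p [:[:c:]:]) v = 0"
      using assms[of "vector [v $ 1, v $ 2, c]"] by (simp add: eval2_def eval3_def)
  qed
qed (simp add: inj_on_def)

lemma eval3_eq_sum:
  "eval3 p v = (\<Sum>k\<le>Polynomial.degree p. \<Sum>j\<le>Polynomial.degree (Polynomial.coeff p k).
     \<Sum>i\<le>Polynomial.degree (Polynomial.coeff (Polynomial.coeff p k) j).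
       Polynomial.coeff (Polynomial.coeff (Polynomial.coeff p k) j) i * v $ 1 ^ i * v $ 2 ^ j * v $ 3 ^ k)"
proof -
  have 1: "eval3 p v = (\<Sum>k\<le>Polynomial.degree p. poly (poly (Polynomial.coeff p k) [:v $ 2:]) (v $ 1) * v $ 3 ^ k)"
    by (simp add: eval3_def poly_altdef[of p] poly_sum)
  have 2: "poly (poly q [:b:]) a = (\<Sum>j\<le>Polynomial.degree q. poly (Polynomial.coeff q j) a * b ^ j)"
    for q and a b :: complex
    by (simp add: poly_altdef[of q] poly_sum)
  show ?thesis unfolding 1 2 by (simp only: poly_altdef sum_distrib_right)
qed

text \<open>This makes the vanishing of a homogeneous polynomial, and a quotient of two of equal degree,
  independent of the chosen homogeneous coordinates of a point.\<close>

lemma eval3_homogeneous_scale: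
  assumes "homogeneous d p"
  shows "eval3 p (c *s v) = c ^ d * eval3 p v"
  unfolding eval3_eq_sum sum_distrib_left
proof (intro sum.cong refl)
  fix k j i
  let ?a = "Polynomial.coeff (Polynomial.coeff (Polynomial.coeff p k) j) i"
  show "?a * (c *s v) $ 1 ^ i * (c *s v) $ 2 ^ j * (c *s v) $ 3 ^ k =
    c ^ d * (?a * v $ 1 ^ i * v $ 2 ^ j * v $ 3 ^ k)"
  proof (cases "?a = 0")
    case False
    then have "d = i + j + k" using assms by (auto simp: homogeneous_def)
    then show ?thesis by (simp add: power_mult_distrib power_add)
  qed simp
qed

lemma homogeneous_add:
  assumes "homogeneous d p" "homogeneous d q"
  shows "homogeneous d (p + q)"
  using assms unfolding homogeneous_def by (metis add_0 coeff_add)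

lemma homogeneous_uminus:
  "homogeneous d p \<Longrightarrow> homogeneous d (- p)"
  unfolding homogeneous_def by simp

lemma homogeneous_mult:
  assumes "homogeneous d p" "homogeneous e q"
  shows "homogeneous (d + e) (p * q)"
  unfolding homogeneous_def
proof (intro allI impI)
  fix i j k
  assume "Polynomial.coeff (Polynomial.coeff (Polynomial.coeff (p * q) k) j) i \<noteq> 0"
  then have "(\<Sum>k'\<le>k. \<Sum>j'\<le>j. \<Sum>i'\<le>i.
      Polynomial.coeff (Polynomial.coeff (Polynomial.coeff p k') j') i' *
      Polynomial.coeff (Polynomial.coeff (Polynomial.coeff q (k - k')) (j - j')) (i - i')) \<noteq> 0"
    by (simp add: coeff_mult coeff_sum)
  then obtain k' j' i' where le: "k' \<le> k" "j' \<le> j" "i' \<le> i"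
    and "Polynomial.coeff (Polynomial.coeff (Polynomial.coeff p k') j') i' *
      Polynomial.coeff (Polynomial.coeff (Polynomial.coeff q (k - k')) (j - j')) (i - i') \<noteq> 0"
    by (metis (no_types, lifting) sum.neutral atMost_iff)
  then have "Polynomial.coeff (Polynomial.coeff (Polynomial.coeff p k') j') i' \<noteq> 0"
    "Polynomial.coeff (Polynomial.coeff (Polynomial.coeff q (k - k')) (j - j')) (i - i') \<noteq> 0"
    by auto
  then have "i' + j' + k' = d" "(i - i') + (j - j') + (k - k') = e"
    using assms unfolding homogeneous_def by blast+
  with le show "i + j + k = d + e" by linarith
qed

lemma homogeneous_const: "homogeneous 0 [:[:[:c:]:]:]"
  by (auto simp: homogeneous_def coeff_pCons split: nat.splits)

lemma homogeneous_1: "homogeneous 0 1"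
  using homogeneous_const[of 1] unfolding pCons_one .

lemma homogeneous_variables:
  "homogeneous 1 [:[:[:0, 1:]:]:]" "homogeneous 1 [:[:0, 1:]:]" "homogeneous 1 [:0, 1:]"
  by (auto simp: homogeneous_def coeff_pCons split: nat.splits)

section \<open>Points of the projective plane\<close>

lemma abs_P2_eq_iff:
  assumes "v \<noteq> 0" "w \<noteq> 0"
  shows "abs_P2 v = abs_P2 w \<longleftrightarrow> (\<exists>c. w = c *s v)"
proof -
  have "scalar_equiv v v" "scalar_equiv w w"
    using assms by (auto simp: scalar_equiv_def intro: exI[of _ 1])
  then have "abs_P2 v = abs_P2 w \<longleftrightarrow> scalar_equiv v w"
    using Quotient_rel_abs2[OF Quotient_P2] Quotient_rel[OF Quotient_P2] by metis
  then show ?thesis using assms by (simp add: scalar_equiv_def)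
qed

lemma P2_cases:
  obtains v where "v \<noteq> 0" "x = abs_P2 v"
proof -
  have "scalar_equiv (rep_P2 x) (rep_P2 x)" "abs_P2 (rep_P2 x) = x"
    by (rule Quotient_rep_reflp[OF Quotient_P2], rule Quotient_abs_rep[OF Quotient_P2])
  then show ?thesis using that[of "rep_P2 x"] unfolding scalar_equiv_def by simp
qed

section \<open>Values of rational functions\<close>

text \<open>Values may be computed from any representation of a rational function. Together with the
  closure properties below, this makes evaluation at a point a ring homomorphism on the local
  ring of that point.\<close>

lemma has_value_A2_unique:
  assumes "has_value_A2 b v c" "has_value_A2 b v c'"
  shows "c = c'"
proof -
  obtain g h where 1: "b = Fraction_Field.Fract g h" "eval2 h v \<noteq> 0" "c = eval2 g v / eval2 h v"
    using assms(1) by (auto simp: has_value_A2_def)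
  obtain g' h' where 2: "b = Fraction_Field.Fract g' h'" "eval2 h' v \<noteq> 0" "c' = eval2 g' v / eval2 h' v"
    using assms(2) by (auto simp: has_value_A2_def)
  have "h \<noteq> 0" "h' \<noteq> 0" using 1 2 by auto
  then have "g * h' = g' * h" using 1 2 by (simp add: eq_fract)
  then have "eval2 g v * eval2 h' v = eval2 g' v * eval2 h v" by (metis eval2_simps(6))
  then show ?thesis using 1 2 by (simp add: frac_eq_eq)
qed

lemma has_value_A2_Fract:
  "eval2 h v \<noteq> 0 \<Longrightarrow> has_value_A2 (Fraction_Field.Fract g h) v (eval2 g v / eval2 h v)"
  by (auto simp: has_value_A2_def)

lemma has_value_A2_add:
  assumes "has_value_A2 a v c" "has_value_A2 b v c'"
  shows "has_value_A2 (a + b) v (c + c')"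
proof -
  obtain g h where 1: "a = Fraction_Field.Fract g h" "eval2 h v \<noteq> 0" "c = eval2 g v / eval2 h v"
    using assms(1) by (auto simp: has_value_A2_def)
  obtain g' h' where 2: "b = Fraction_Field.Fract g' h'" "eval2 h' v \<noteq> 0" "c' = eval2 g' v / eval2 h' v"
    using assms(2) by (auto simp: has_value_A2_def)
  have "h \<noteq> 0" "h' \<noteq> 0" using 1 2 by auto
  then have "a + b = Fraction_Field.Fract (g * h' + g' * h) (h * h')" using 1 2 by simp
  with has_value_A2_Fract[of "h * h'" v "g * h' + g' * h"] 1 2
  show ?thesis by (simp add: add_divide_distrib)
qed

lemma has_value_A2_mult:
  assumes "has_value_A2 a v c" "has_value_A2 b v c'"
  shows "has_value_A2 (a * b) v (c * c')"
proof -
  obtain g h where 1: "a = Fraction_Field.Fract g h" "eval2 h v \<noteq> 0" "c = eval2 g v / eval2 h v"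
    using assms(1) by (auto simp: has_value_A2_def)
  obtain g' h' where 2: "b = Fraction_Field.Fract g' h'" "eval2 h' v \<noteq> 0" "c' = eval2 g' v / eval2 h' v"
    using assms(2) by (auto simp: has_value_A2_def)
  show ?thesis using has_value_A2_Fract[of "h * h'" v "g * g'"] 1 2 by simp
qed

lemma has_value_A2_inverse:
  assumes "has_value_A2 a v c" "c \<noteq> 0"
  shows "has_value_A2 (inverse a) v (inverse c)"
proof -
  obtain g h where 1: "a = Fraction_Field.Fract g h" "eval2 h v \<noteq> 0" "c = eval2 g v / eval2 h v"
    using assms(1) by (auto simp: has_value_A2_def)
  show ?thesis using has_value_A2_Fract[of g v h] 1 assms(2) by simp
qed

lemma nonempty_zariski_open_A2:
  assumes "zariski_open_A2 U" "U \<noteq> {}"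
  obtains q where "q \<noteq> 0" "\<And>v. eval2 q v \<noteq> 0 \<Longrightarrow> v \<in> U"
proof -
  obtain T where T: "- U = {v. \<forall>p\<in>T. eval2 p v = 0}"
    using assms(1) by (auto simp: zariski_open_A2_def)
  obtain u where "u \<in> U" using assms(2) by blast
  with T obtain q where q: "q \<in> T" "eval2 q u \<noteq> 0" by auto
  show ?thesis
  proof (rule that[of q])
    show "q \<noteq> 0" using q by auto
    show "v \<in> U" if "eval2 q v \<noteq> 0" for v using that q(1) T by auto
  qed
qed

text \<open>A polynomial that vanishes where \<open>q\<close> does not is zero, since its product with \<open>q\<close> vanishes
  everywhere. So identities between rational functions can be checked at generic points.\<close>

lemma rational_function_eqI:
  assumes "q \<noteq> 0"
    and "\<And>v. eval2 q v \<noteq> 0 \<Longrightarrow> \<exists>c. has_value_A2 a v c \<and> has_value_A2 b v c"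
  shows "a = b"
proof -
  obtain g h where 1: "a = Fraction_Field.Fract g h" "h \<noteq> 0" by (cases a)
  obtain g' h' where 2: "b = Fraction_Field.Fract g' h'" "h' \<noteq> 0" by (cases b)
  have "q * h * h' * (g * h' - g' * h) = 0"
  proof (rule eval2_eq_0_imp)
    fix v
    show "eval2 (q * h * h' * (g * h' - g' * h)) v = 0"
    proof (cases "eval2 q v = 0 \<or> eval2 h v = 0 \<or> eval2 h' v = 0")
      case False
      then obtain c where "has_value_A2 a v c" "has_value_A2 b v c" using assms(2) by blast
      then have "c = eval2 g v / eval2 h v" "c = eval2 g' v / eval2 h' v"
        using False 1 2 has_value_A2_unique has_value_A2_Fract by metis+
      then show ?thesis using False by (simp add: field_simps)
    qed auto
  qed
  with assms(1) 1 2 show ?thesis by (simp add: eq_fract)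
qed

section \<open>Maps given by three polynomials without common zeros\<close>

locale polynomial_lift =
  fixes G :: "A2 \<Rightarrow> complex^3"
  assumes polynomial: "\<exists>q. \<forall>v. eval2 q v = G v $ i"
    and nonzero: "G v \<noteq> 0"
begin

definition map_P2 :: "A2 \<Rightarrow> P2" where "map_P2 v = abs_P2 (G v)"

text \<open>A polynomial is determined by its values (\<open>eval2_inject\<close>), so the choice is unique and
  \<open>subst_lift\<close> inherits the algebraic laws of evaluation.\<close>

definition subst_lift :: "complex poly poly poly \<Rightarrow> complex poly poly" where
  "subst_lift p = (SOME q. \<forall>v. eval2 q v = eval3 p (G v))"

text \<open>Horner's scheme, one variable at a time, writes the composition as sums and products of the
  coordinates of \<open>G\<close>.\<close>

lemma polynomial_eval3: "\<exists>q. \<forall>v. eval2 q v = eval3 p (G v)"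
proof -
  obtain Q where Q: "eval2 (Q i) v = G v $ i" for i v using polynomial by metis
  have 1: "\<exists>q. \<forall>v. eval2 q v = eval3 [:[:p:]:] (G v)" for p
  proof (induction p)
    case (pCons a p)
    then obtain q where "\<forall>v. eval2 q v = eval3 [:[:p:]:] (G v)" by blast
    then show ?case
      by (intro exI[of _ "[:[:a:]:] + Q 1 * q"]) (simp only: eval2_simps Q, simp add: eval3_def)
  qed (auto intro: exI[of _ 0])
  have 2: "\<exists>q. \<forall>v. eval2 q v = eval3 [:p:] (G v)" for p
  proof (induction p)
    case (pCons a p)
    then obtain q r where "\<forall>v. eval2 q v = eval3 [:p:] (G v)" "\<forall>v. eval2 r v = eval3 [:[:a:]:] (G v)"
      using 1 by blast
    then show ?case
      by (intro exI[of _ "r + Q 2 * q"]) (simp only: eval2_simps Q, simp add: eval3_def)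
  qed (auto intro: exI[of _ 0])
  show ?thesis
  proof (induction p)
    case (pCons a p)
    then obtain q r where "\<forall>v. eval2 q v = eval3 p (G v)" "\<forall>v. eval2 r v = eval3 [:a:] (G v)"
      using 2 by blast
    then show ?case
      by (intro exI[of _ "r + Q 3 * q"]) (simp only: eval2_simps Q, simp add: eval3_def)
  qed (auto intro: exI[of _ 0])
qed

lemma eval2_subst_lift [simp]: "eval2 (subst_lift p) v = eval3 p (G v)"
  using someI_ex[OF polynomial_eval3, of p] unfolding subst_lift_def by blast

lemma subst_lift_simps:
  "subst_lift (p + q) = subst_lift p + subst_lift q"
  "subst_lift (p * q) = subst_lift p * subst_lift q"
  "subst_lift (- p) = - subst_lift p"
  "subst_lift 1 = 1"
  "subst_lift [:[:[:c:]:]:] = [:[:c:]:]"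
  by (rule eval2_inject, simp)+

lemma open_vimage:
  assumes "zariski_open_P2 U"
  shows "zariski_open_A2 (map_P2 -` U)"
proof -
  obtain T where T: "\<forall>p\<in>T. \<exists>d. homogeneous d p"
      "- U = {abs_P2 v | v. v \<noteq> 0 \<and> (\<forall>p\<in>T. eval3 p v = 0)}"
    using assms by (auto simp: zariski_open_P2_def)
  have "map_P2 v \<in> - U \<longleftrightarrow> (\<forall>p\<in>T. eval3 p (G v) = 0)" for v
  proof
    assume "map_P2 v \<in> - U"
    then obtain w where w: "w \<noteq> 0" "abs_P2 w = abs_P2 (G v)" "\<forall>p\<in>T. eval3 p w = 0"
      using T(2) by (auto simp: map_P2_def)
    then obtain c where "G v = c *s w" using abs_P2_eq_iff nonzero by blast
    then show "\<forall>p\<in>T. eval3 p (G v) = 0" using T(1) w(3) eval3_homogeneous_scale by fastforce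
  next
    assume "\<forall>p\<in>T. eval3 p (G v) = 0"
    then show "map_P2 v \<in> - U" unfolding T(2) map_P2_def using nonzero by blast
  qed
  then have "- (map_P2 -` U) = {v. \<forall>p\<in>subst_lift ` T. eval2 p v = 0}" by auto
  then show ?thesis unfolding zariski_open_A2_def by blast
qed

lemma morphism: "morphism_A2_P2 map_P2"
  unfolding morphism_A2_P2_def
proof (intro conjI allI impI open_vimage)
  fix U r
  assume U: "zariski_open_P2 U \<and> regular_on_P2 U r"
  show "regular_on_A2 (map_P2 -` U) (r \<circ> map_P2)"
    unfolding regular_on_A2_def
  proof
    fix u
    assume "u \<in> map_P2 -` U"
    then have "map_P2 u \<in> U" by simp
    then obtain W d g h where W: "zariski_open_P2 W" "map_P2 u \<in> W" "W \<subseteq> U"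
      "\<forall>v. v \<noteq> 0 \<and> abs_P2 v \<in> W \<longrightarrow> eval3 h v \<noteq> 0 \<and> r (abs_P2 v) = eval3 g v / eval3 h v"
      using U unfolding regular_on_P2_def by blast
    show "\<exists>W g h. zariski_open_A2 W \<and> u \<in> W \<and> W \<subseteq> map_P2 -` U \<and>
        (\<forall>v\<in>W. eval2 h v \<noteq> 0 \<and> (r \<circ> map_P2) v = eval2 g v / eval2 h v)"
    proof (intro exI conjI ballI)
      show "zariski_open_A2 (map_P2 -` W)" using W(1) by (rule open_vimage)
      show "u \<in> map_P2 -` W" "map_P2 -` W \<subseteq> map_P2 -` U" using W by auto
    next
      fix v assume "v \<in> map_P2 -` W"
      then have "eval3 h (G v) \<noteq> 0 \<and> r (abs_P2 (G v)) = eval3 g (G v) / eval3 h (G v)"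
        using W(4) nonzero by (simp add: map_P2_def)
      then show "eval2 (subst_lift h) v \<noteq> 0"
        "(r \<circ> map_P2) v = eval2 (subst_lift g) v / eval2 (subst_lift h) v"
        by (auto simp: map_P2_def)
    qed
  qed
qed

text \<open>A homogeneous polynomial whose pullback is zero vanishes on the image of the map, hence
  on the whole projective plane.\<close>

lemma subst_lift_nonzero:
  assumes "surj map_P2" "homogeneous d h" "h \<noteq> 0"
  shows "subst_lift h \<noteq> 0"
proof
  assume 0: "subst_lift h = 0"
  have vanish: "eval3 h w = 0" if w: "w \<noteq> 0" for w
  proof -
    obtain v where "abs_P2 w = abs_P2 (G v)" using assms(1) by (metis surjD map_P2_def)
    then have "abs_P2 (G v) = abs_P2 w" by simp
    then obtain c where "w = c *s G v" using abs_P2_eq_iff w nonzero by blast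
    moreover have "eval3 h (G v) = 0" using 0 eval2_subst_lift[of h v] by simp
    ultimately show ?thesis using eval3_homogeneous_scale[OF assms(2)] by simp
  qed
  \<comment> \<open>The coordinate factor takes care of the origin.\<close>
  have "eval3 ([:0, 1:] * h) w = 0" for w
    unfolding eval3_simps using vanish[of w] by (cases "w = 0") simp_all
  then have "[:0, 1:] * h = 0" by (rule eval3_eq_0_imp)
  then show False using assms(3) by simp
qed

text \<open>The fractions witnessing a value in \<open>is_pullback\<close> vary from point to point. Cross
  multiplication carries their value over to the one fixed fraction \<open>g / h\<close>, and agreement at
  generic points then determines \<open>b\<close>.\<close>

lemma pullback_eq_subst_lift:
  assumes "is_pullback map_P2 (Fraction_Field.Fract g h) b"
    and "homogeneous d g" "homogeneous d h" "h \<noteq> 0" "subst_lift h \<noteq> 0"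
  shows "b = Fraction_Field.Fract (subst_lift g) (subst_lift h)"
proof -
  obtain U where U: "zariski_open_A2 U" "U \<noteq> {}"
    "\<forall>v\<in>U. \<exists>c. has_value_P2 (Fraction_Field.Fract g h) (map_P2 v) c \<and> has_value_A2 b v c"
    using assms(1) by (auto simp: is_pullback_def)
  obtain q where q: "q \<noteq> 0" "\<And>v. eval2 q v \<noteq> 0 \<Longrightarrow> v \<in> U"
    using nonempty_zariski_open_A2[OF U(1,2)] by blast
  show ?thesis
  proof (rule rational_function_eqI[of "q * subst_lift h"])
    show "q * subst_lift h \<noteq> 0" using q(1) assms(5) by simp
  next
    fix v
    assume "eval2 (q * subst_lift h) v \<noteq> 0"
    then have v: "v \<in> U" "eval3 h (G v) \<noteq> 0" using q(2) by auto
    then obtain c where c: "has_value_P2 (Fraction_Field.Fract g h) (map_P2 v) c" "has_value_A2 b v c"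
      using U(3) by blast
    obtain g' h' d' w where w: "Fraction_Field.Fract g h = Fraction_Field.Fract g' h'"
      "homogeneous d' g'" "homogeneous d' h'" "w \<noteq> 0" "map_P2 v = abs_P2 w" "eval3 h' w \<noteq> 0"
      "c = eval3 g' w / eval3 h' w"
      using c(1) unfolding has_value_P2_def by blast
    obtain k where k: "w = k *s G v"
      using abs_P2_eq_iff[of "G v" w] nonzero w(4,5) by (auto simp: map_P2_def)
    have "h' \<noteq> 0" using w(6) by auto
    then have "g * h' = g' * h" using w(1) assms(4) by (simp add: eq_fract)
    then have "eval3 g w * eval3 h' w = eval3 g' w * eval3 h w" by (metis eval3_simps(6))
    moreover have "eval3 h w \<noteq> 0"
      using v(2) w(4) k by (auto simp: eval3_homogeneous_scale[OF assms(3)])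
    ultimately have "c = eval3 g w / eval3 h w" using w(6,7) by (simp add: frac_eq_eq)
    also have "\<dots> = eval3 g (G v) / eval3 h (G v)"
      using w(4) k by (auto simp: eval3_homogeneous_scale[OF assms(2)] eval3_homogeneous_scale[OF assms(3)])
    finally show "\<exists>c. has_value_A2 b v c \<and>
        has_value_A2 (Fraction_Field.Fract (subst_lift g) (subst_lift h)) v c"
      using c(2) v(2) has_value_A2_Fract[of "subst_lift h" v "subst_lift g"] by auto
  qed
qed

lemma is_pullback_Fract:
  assumes "homogeneous d g" "homogeneous d h" "subst_lift h \<noteq> 0"
  shows "is_pullback map_P2 (Fraction_Field.Fract g h) (Fraction_Field.Fract (subst_lift g) (subst_lift h))"
  unfolding is_pullback_def
proof (intro exI conjI ballI)
  let ?U = "{v. eval2 (subst_lift h) v \<noteq> 0}"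
  have "- ?U = {v. \<forall>p\<in>{subst_lift h}. eval2 p v = 0}" by auto
  then show "zariski_open_A2 ?U" unfolding zariski_open_A2_def by blast
  show "?U \<noteq> {}" using assms(3) eval2_eq_0_imp[of "subst_lift h"] by blast
  fix v assume v: "v \<in> ?U"
  then show "has_value_A2 (Fraction_Field.Fract (subst_lift g) (subst_lift h)) v
      (eval2 (subst_lift g) v / eval2 (subst_lift h) v)"
    using has_value_A2_Fract by blast
  show "has_value_P2 (Fraction_Field.Fract g h) (map_P2 v)
      (eval2 (subst_lift g) v / eval2 (subst_lift h) v)"
    unfolding has_value_P2_def map_P2_def using assms(1,2) nonzero[of v] v
    by (intro exI[of _ g] exI[of _ h] exI[of _ d] exI[of _ "G v"]) simp
qed

context
  assumes surj: "surj map_P2"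
begin

lemma pullback_field_eq:
  "pullback_field map_P2 = {Fraction_Field.Fract (subst_lift g) (subst_lift h) | g h d.
     homogeneous d g \<and> homogeneous d h \<and> h \<noteq> 0}"
proof (intro equalityI subsetI)
  fix b assume "b \<in> pullback_field map_P2"
  then obtain g h d where "homogeneous d g" "homogeneous d h" "h \<noteq> 0"
      "is_pullback map_P2 (Fraction_Field.Fract g h) b"
    unfolding pullback_field_def function_field_P2_def by blast
  moreover from this have "b = Fraction_Field.Fract (subst_lift g) (subst_lift h)"
    using pullback_eq_subst_lift subst_lift_nonzero[OF surj] by blast
  ultimately show "b \<in> {Fraction_Field.Fract (subst_lift g) (subst_lift h) | g h d.
     homogeneous d g \<and> homogeneous d h \<and> h \<noteq> 0}" by blast
next
  fix b assume "b \<in> {Fraction_Field.Fract (subst_lift g) (subst_lift h) | g h d.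
     homogeneous d g \<and> homogeneous d h \<and> h \<noteq> 0}"
  then obtain g h d where *: "b = Fraction_Field.Fract (subst_lift g) (subst_lift h)"
    "homogeneous d g" "homogeneous d h" "h \<noteq> 0" by blast
  then have "is_pullback map_P2 (Fraction_Field.Fract g h) b"
    using is_pullback_Fract subst_lift_nonzero[OF surj] by blast
  with * show "b \<in> pullback_field map_P2"
    unfolding pullback_field_def function_field_P2_def by blast
qed

lemma pullback_fieldI:
  assumes "homogeneous d g" "homogeneous d h" "h \<noteq> 0"
  shows "Fraction_Field.Fract (subst_lift g) (subst_lift h) \<in> pullback_field map_P2"
  using assms unfolding pullback_field_eq by blast

lemma pullback_fieldE:
  assumes "b \<in> pullback_field map_P2"
  obtains g h d where "homogeneous d g" "homogeneous d h" "h \<noteq> 0" "subst_lift h \<noteq> 0"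
    "b = Fraction_Field.Fract (subst_lift g) (subst_lift h)"
  using assms subst_lift_nonzero[OF surj] unfolding pullback_field_eq by blast

lemma const_in_pullback_field: "Fraction_Field.Fract [:[:c:]:] 1 \<in> pullback_field map_P2"
  using pullback_fieldI[OF homogeneous_const homogeneous_1, of c] by (simp add: subst_lift_simps)

text \<open>Homogeneity makes the denominator nonzero at both points of a fibre as soon as it is
  nonzero at one of them; hence the assumption on \<open>q\<close> concerns \<open>v\<close> alone.\<close>

lemma pullback_field_constant_on_fibres:
  assumes "b \<in> pullback_field map_P2"
  obtains q where "q \<noteq> 0"
    "\<And>v v'. map_P2 v = map_P2 v' \<Longrightarrow> eval2 q v \<noteq> 0 \<Longrightarrow> \<exists>c. has_value_A2 b v c \<and> has_value_A2 b v' c"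
proof -
  obtain g h d where b: "homogeneous d g" "homogeneous d h" "subst_lift h \<noteq> 0"
    "b = Fraction_Field.Fract (subst_lift g) (subst_lift h)"
    using pullback_fieldE[OF assms] by metis
  show ?thesis
  proof (rule that[OF b(3)])
    fix v v'
    assume v: "map_P2 v = map_P2 v'" "eval2 (subst_lift h) v \<noteq> 0"
    obtain k where k: "G v' = k *s G v"
      using abs_P2_eq_iff[of "G v" "G v'"] nonzero v(1) by (auto simp: map_P2_def)
    then have "k \<noteq> 0" using nonzero[of v'] by auto
    then have "eval2 (subst_lift h) v' \<noteq> 0"
      "eval2 (subst_lift g) v' / eval2 (subst_lift h) v' = eval2 (subst_lift g) v / eval2 (subst_lift h) v"
      using v(2) k by (auto simp: eval3_homogeneous_scale[OF b(1)] eval3_homogeneous_scale[OF b(2)])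
    then show "\<exists>c. has_value_A2 b v c \<and> has_value_A2 b v' c"
      unfolding b(4) using has_value_A2_Fract v(2) by metis
  qed
qed

end

end


section \<open>Towers of quadratic extensions\<close>

text \<open>Since \<open>inverse 0 = 0\<close>, closure under \<open>inverse\<close> needs no exception for zero.\<close>

lemma subfield_ring_of_type_algebra_iff:
  fixes K :: "'a :: field set"
  shows "subfield K ring_of_type_algebra \<longleftrightarrow>
    1 \<in> K \<and> (\<forall>a\<in>K. - a \<in> K \<and> inverse a \<in> K \<and> (\<forall>b\<in>K. a + b \<in> K \<and> a * b \<in> K))"
    (is "_ \<longleftrightarrow> ?closed")
proof -
  let ?R = "ring_of_type_algebra :: 'a ring"
  interpret R: Ring.field ?R by (rule field_from_type_algebra)
  note R_simps = ring_of_type_algebra_def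
  have uminus: "\<ominus>\<^bsub>?R\<^esub> a = - a" for a
    by (rule R.minus_equality) (simp_all add: R_simps)
  have inv: "inv\<^bsub>?R\<^esub> a = inverse a" if "a \<noteq> 0" for a
    using that by (intro R.comm_inv_char) (simp_all add: R_simps)
  show ?thesis
  proof
    assume K: "subfield K ?R"
    then have sr: "subring K ?R" by (simp add: subfieldE)
    have "0 \<in> K" "1 \<in> K" using subringE(2,3)[OF sr] by (simp_all add: R_simps)
    moreover have "inverse a \<in> K" if "a \<in> K" "a \<noteq> 0" for a
      using R.subfield_m_inv(1)[OF K, of a] that inv by (simp add: R_simps)
    ultimately show ?closed
      using subringE(5,6,7)[OF sr] uminus by (auto simp: R_simps) (metis inverse_zero)
  next
    assume closed: ?closed
    show "subfield K ?R"
    proof (rule R.subfieldI'[OF R.subringI])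
      show "K \<subseteq> carrier ?R" by (simp add: R_simps)
      show "\<one>\<^bsub>?R\<^esub> \<in> K" using closed by (simp add: R_simps)
      show "\<ominus>\<^bsub>?R\<^esub> a \<in> K" if "a \<in> K" for a using closed that uminus by simp
      show "a \<otimes>\<^bsub>?R\<^esub> b \<in> K" "a \<oplus>\<^bsub>?R\<^esub> b \<in> K" if "a \<in> K" "b \<in> K" for a b
        using closed that by (simp_all add: R_simps)
      show "inv\<^bsub>?R\<^esub> a \<in> K" if "a \<in> K - {\<zero>\<^bsub>?R\<^esub>}" for a
        using closed that inv by (auto simp: R_simps)
    qed
  qed
qed

definition adjoin_quadratic :: "'a :: field set \<Rightarrow> 'a \<Rightarrow> 'a set" where
  "adjoin_quadratic K z = {a + b * z | a b. a \<in> K \<and> b \<in> K}"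

text \<open>Reduction by the quadratic relation keeps products of the form \<open>a + b * z\<close>, and inverses come
  from dividing the conjugate by the norm. The norm vanishes only at zero because \<open>z \<notin> K\<close>. The
  same condition makes \<open>1, z\<close> a basis.\<close>

lemma quadratic_extension:
  fixes K :: "'a :: field set"
  assumes K: "subfield K ring_of_type_algebra"
    and z: "z \<notin> K" "z * z = \<alpha> * z + \<beta>" "\<alpha> \<in> K" "\<beta> \<in> K"
  shows "subfield (adjoin_quadratic K z) ring_of_type_algebra"
    and "ring.dimension ring_of_type_algebra 2 K (adjoin_quadratic K z)"
proof -
  let ?E = "adjoin_quadratic K z"
  let ?R = "ring_of_type_algebra :: 'a ring"
  interpret R: Ring.field ?R by (rule field_from_type_algebra)
  have one: "1 \<in> K" and neg: "\<And>a. a \<in> K \<Longrightarrow> - a \<in> K" and inv: "\<And>a. a \<in> K \<Longrightarrow> inverse a \<in> K"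
    and add: "\<And>a b. a \<in> K \<Longrightarrow> b \<in> K \<Longrightarrow> a + b \<in> K" and mult: "\<And>a b. a \<in> K \<Longrightarrow> b \<in> K \<Longrightarrow> a * b \<in> K"
    using K unfolding subfield_ring_of_type_algebra_iff by blast+
  have zero: "0 \<in> K" using add[OF one neg[OF one]] by simp
  have EI: "a + b * z \<in> ?E" if "a \<in> K" "b \<in> K" for a b
    using that unfolding adjoin_quadratic_def by blast
  have E_inverse: "inverse (a + b * z) \<in> ?E" if ab: "a \<in> K" "b \<in> K" for a b
  proof (cases "b = 0 \<or> a + b * z = 0")
    case True
    then show ?thesis using EI[OF inv[OF ab(1)] zero] EI[OF zero zero] by auto
  next
    case False
    \<comment> \<open>The norm of \<open>a + b * z\<close> is its product with the conjugate \<open>a + b * (\<alpha> - z)\<close>.\<close>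
    define N where "N = a * a + a * b * \<alpha> + - (b * b * \<beta>)"
    have N: "(a + b * z) * (a + b * \<alpha> - b * z) = N"
    proof -
      have "(a + b * z) * (a + b * \<alpha> - b * z) = a * a + a * b * \<alpha> + b * b * (\<alpha> * z - z * z)"
        by (simp add: algebra_simps)
      then show ?thesis by (simp add: z(2) N_def)
    qed
    have "a + b * \<alpha> - b * z \<noteq> 0"
    proof
      assume "a + b * \<alpha> - b * z = 0"
      then have "z = a * inverse b + \<alpha>" using False by (simp add: field_simps)
      then show False using z(1,3) ab inv add mult by metis
    qed
    then have "N \<noteq> 0" using N False by auto
    have "inverse (a + b * z) * N = a + b * \<alpha> - b * z"
      using False by (simp flip: N)
    then have "inverse (a + b * z) = (a + b * \<alpha> - b * z) * inverse N"
      using \<open>N \<noteq> 0\<close> by (metis mult.assoc mult.right_neutral right_inverse)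
    then have "inverse (a + b * z) = (a + b * \<alpha>) * inverse N + (- b * inverse N) * z"
      by (simp add: algebra_simps)
    moreover have "N \<in> K" unfolding N_def by (intro add mult neg ab z)
    ultimately show ?thesis using EI add mult neg inv ab z(3) by metis
  qed
  show "subfield ?E ?R"
    unfolding subfield_ring_of_type_algebra_iff
  proof (intro conjI ballI)
    show "1 \<in> ?E" using EI[OF one zero] by simp
    fix e assume "e \<in> ?E"
    then obtain a b where e: "a \<in> K" "b \<in> K" "e = a + b * z" by (auto simp: adjoin_quadratic_def)
    show "- e \<in> ?E" using EI[OF neg[OF e(1)] neg[OF e(2)]] e(3) by simp
    show "inverse e \<in> ?E" using E_inverse e by simp
    fix e' assume "e' \<in> ?E"
    then obtain a' b' where e': "a' \<in> K" "b' \<in> K" "e' = a' + b' * z" by (auto simp: adjoin_quadratic_def)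
    have "e + e' = (a + a') + (b + b') * z" using e e' by (simp add: algebra_simps)
    then show "e + e' \<in> ?E" using EI e e' add by metis
    have "e * e' = a * a' + (a * b' + b * a') * z + b * b' * (z * z)"
      using e(3) e'(3) by (simp add: algebra_simps)
    then have "e * e' = (a * a' + b * b' * \<beta>) + (a * b' + b * a' + b * b' * \<alpha>) * z"
      by (simp add: z(2) algebra_simps)
    then show "e * e' \<in> ?E" using EI e e' add mult z by metis
  qed
  have line_extension: "R.line_extension K u V = {v + k * u | v k. v \<in> V \<and> k \<in> K}" for u V
    unfolding R.line_extension_def set_add_def set_mult_def r_coset_def
    by (auto simp: ring_of_type_algebra_def) (metis add.commute)+
  have "R.dimension (Suc 1) K (R.line_extension K z K)"
    using z(1) by (intro R.Suc_dim R.dimension_one[OF K]) (simp add: ring_of_type_algebra_def)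
  then show "R.dimension 2 K ?E"
    unfolding line_extension adjoin_quadratic_def by (simp add: numeral_2_eq_2)
qed

section \<open>The covering and its fibres\<close>

definition sym_lift :: "A2 \<Rightarrow> complex^3" where
  "sym_lift v = vector [(v$1^2 + 1) * (v$2^2 + 1), (v$1^2 + 1) * v$2 + v$1 * (v$2^2 + 1), v$1 * v$2]"

lemma sym_lift_nth [simp]:
  "sym_lift v $ 1 = (v$1^2 + 1) * (v$2^2 + 1)"
  "sym_lift v $ 2 = (v$1^2 + 1) * v$2 + v$1 * (v$2^2 + 1)"
  "sym_lift v $ 3 = v$1 * v$2"
  by (simp_all add: sym_lift_def)

interpretation sym: polynomial_lift sym_lift
proof
  fix i :: 3
  show "\<exists>q. \<forall>v. eval2 q v = sym_lift v $ i"
  proof -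
    consider "i = 1" | "i = 2" | "i = 3" using exhaust_3 by blast
    then show ?thesis
    proof cases
      case 1
      show ?thesis unfolding 1
        by (intro exI[of _ "([:[:0, 1:]:] ^ 2 + 1) * ([:0, 1:] ^ 2 + 1)"] allI)
          (simp only: eval2_simps sym_lift_nth)
    next
      case 2
      show ?thesis unfolding 2
        by (intro exI[of _ "([:[:0, 1:]:] ^ 2 + 1) * [:0, 1:] + [:[:0, 1:]:] * ([:0, 1:] ^ 2 + 1)"] allI)
          (simp only: eval2_simps sym_lift_nth)
    next
      case 3
      show ?thesis unfolding 3
        by (intro exI[of _ "[:[:0, 1:]:] * [:0, 1:]"] allI) (simp only: eval2_simps sym_lift_nth)
    qed
  qed
next
  fix v
  have "sym_lift v $ 1 \<noteq> 0 \<or> sym_lift v $ 2 \<noteq> 0" if "sym_lift v $ 3 = 0"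
    using that by (auto simp: power2_eq_square)
  then show "sym_lift v \<noteq> 0" by (metis zero_index)
qed

abbreviation cover :: "A2 \<Rightarrow> P2" where "cover \<equiv> sym.map_P2"

lemma cover_eq_iff:
  assumes "w \<noteq> 0"
  shows "cover v = abs_P2 w \<longleftrightarrow> (\<exists>c. w = c *s sym_lift v)"
  unfolding sym.map_P2_def using abs_P2_eq_iff sym.nonzero assms by blast

lemma vec3_eq_iff: "(v :: complex^3) = w \<longleftrightarrow> v $ 1 = w $ 1 \<and> v $ 2 = w $ 2 \<and> v $ 3 = w $ 3"
  by (simp add: vec_eq_iff forall_3)

lemma quadratic_root: "\<exists>z::complex. z ^ 2 = a * z + b"
proof -
  define d where "d = csqrt (a ^ 2 + 4 * b)"
  have "((a + d) / 2) ^ 2 - (a * ((a + d) / 2) + b) = (d ^ 2 - (a ^ 2 + 4 * b)) / 4"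
    by (simp add: power2_eq_square field_simps)
  also have "\<dots> = 0" by (simp add: d_def)
  finally have "((a + d) / 2) ^ 2 = a * ((a + d) / 2) + b" by simp
  then show ?thesis by blast
qed

text \<open>A quadratic form with \<open>w $ 3 \<noteq> 0\<close> is \<open>w $ 3\<close> times the product of two forms with coefficients
  \<open>[a : 1]\<close> and \<open>[b : 1]\<close>, where \<open>a\<close> and \<open>b\<close> have the prescribed sum and product; then \<open>x + 1/x = a\<close>
  and \<open>y + 1/y = b\<close> are solvable. Forms with \<open>w $ 3 = 0\<close> have the point \<open>[1 : 0]\<close>, the image of
  \<open>0\<close>, as one factor.\<close>

lemma surj_cover: "surj cover"
unfolding surj_def
proof
  fix x
  obtain w where w: "w \<noteq> 0" "x = abs_P2 w" by (rule P2_cases)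
  have "\<exists>v c. w = c *s sym_lift v"
  proof (cases "w $ 3 = 0")
    case False
    obtain a where a: "a ^ 2 = (w $ 2 / w $ 3) * a + (- w $ 1 / w $ 3)" using quadratic_root by blast
    define b where "b = w $ 2 / w $ 3 - a"
    obtain x where x: "x ^ 2 = a * x + (- 1)" using quadratic_root by blast
    obtain y where y: "y ^ 2 = b * y + (- 1)" using quadratic_root by blast
    have "x \<noteq> 0" "y \<noteq> 0" using x y by auto
    have "a * b = w $ 1 / w $ 3" unfolding b_def using a by (simp add: power2_eq_square algebra_simps)
    then have ab: "w $ 1 = w $ 3 * (a * b)" "w $ 2 = w $ 3 * (a + b)" using False by (simp_all add: b_def)
    have "w = (w $ 3 / (x * y)) *s sym_lift (vector [x, y])"
      unfolding vec3_eq_iff using \<open>x \<noteq> 0\<close> \<open>y \<noteq> 0\<close> by (simp add: x y ab field_simps)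
    then show ?thesis by blast
  next
    case w3: True
    show ?thesis
    proof (cases "w $ 2 = 0")
      case True
      then have "w = w $ 1 *s sym_lift (vector [0, 0])" using w3 by (simp add: vec3_eq_iff)
      then show ?thesis by blast
    next
      case False
      obtain x where x: "x ^ 2 = (w $ 1 / w $ 2) * x + (- 1)" using quadratic_root by blast
      then have "x \<noteq> 0" by auto
      then have "w = (w $ 2 / x) *s sym_lift (vector [x, 0])"
        using w3 False x by (simp add: vec3_eq_iff)
      then show ?thesis by blast
    qed
  qed
  then show "\<exists>v. x = cover v" unfolding w(2) using cover_eq_iff[OF w(1)] by metis
qed

text \<open>The two factors of a quadratic form correspond to its roots. Substituting
  \<open>[t\<^sup>2 + 1 : t]\<close> for a root gives a quartic that both coordinates of a point in the fibre satisfy.\<close>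

lemma finite_fibre: "finite (cover -` {x})"
proof -
  obtain w where w: "w \<noteq> 0" "x = abs_P2 w" by (rule P2_cases)
  \<comment> \<open>\<open>w $ 3 * (t\<^sup>2 + 1)\<^sup>2 - w $ 2 * t * (t\<^sup>2 + 1) + w $ 1 * t\<^sup>2\<close>\<close>
  define p where "p = [:w $ 3, - w $ 2, 2 * w $ 3 + w $ 1, - w $ 2, w $ 3:]"
  have "p \<noteq> 0" using w(1) by (auto simp: p_def vec3_eq_iff)
  then have "finite {t. poly p t = 0}" by (rule poly_roots_finite)
  then have "finite ((\<lambda>(x, y). vector [x, y] :: A2) ` ({t. poly p t = 0} \<times> {t. poly p t = 0}))"
    by blast
  moreover have "cover -` {x} \<subseteq> (\<lambda>(x, y). vector [x, y]) ` ({t. poly p t = 0} \<times> {t. poly p t = 0})"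
  proof
    fix v assume "v \<in> cover -` {x}"
    then obtain c where c: "w = c *s sym_lift v" using cover_eq_iff[OF w(1)] w(2) by auto
    have p: "poly p t = w $ 3 * (t ^ 2 + 1) ^ 2 - w $ 2 * t * (t ^ 2 + 1) + w $ 1 * t ^ 2" for t
      by (simp add: p_def power2_eq_square algebra_simps)
    have "c * (x * y) * r\<^sup>2 - c * (r * y + x * s) * x * r + c * (r * s) * x\<^sup>2 = 0"
      "c * (y * x) * r\<^sup>2 - c * (s * x + y * r) * x * r + c * (s * r) * x\<^sup>2 = 0" for x y r s
      by (simp_all add: algebra_simps power2_eq_square)
    then have "poly p (v $ 1) = 0" "poly p (v $ 2) = 0"
      unfolding p c vector_smult_component sym_lift_nth by blast+
    then have "(v $ 1, v $ 2) \<in> {t. poly p t = 0} \<times> {t. poly p t = 0}" by blast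
    moreover have "v = (case (v $ 1, v $ 2) of (x, y) \<Rightarrow> vector [x, y])"
      by (simp add: vec_eq_iff forall_2)
    ultimately show "v \<in> (\<lambda>(x, y). vector [x, y]) ` ({t. poly p t = 0} \<times> {t. poly p t = 0})"
      by (rule rev_image_eqI)
  qed
  ultimately show ?thesis by (rule finite_subset[rotated])
qed

section \<open>Traces and coordinates in the function field\<close>

definition coord1 :: "complex poly poly fract" where "coord1 = Fraction_Field.Fract [:[:0, 1:]:] 1"
definition coord2 :: "complex poly poly fract" where "coord2 = Fraction_Field.Fract [:0, 1:] 1"

lemma has_value_A2_coord1: "has_value_A2 coord1 v (v $ 1)"
  using has_value_A2_Fract[of 1 v "[:[:0, 1:]:]"] by (simp add: coord1_def)

lemma has_value_A2_coord2: "has_value_A2 coord2 v (v $ 2)"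
  using has_value_A2_Fract[of 1 v "[:0, 1:]"] by (simp add: coord2_def)

lemma has_value_A2_coord1_trace:
  "v $ 1 \<noteq> 0 \<Longrightarrow> has_value_A2 (coord1 + inverse coord1) v (v $ 1 + inverse (v $ 1))"
  by (intro has_value_A2_add has_value_A2_inverse has_value_A2_coord1)

lemma has_value_A2_coord2_trace:
  "v $ 2 \<noteq> 0 \<Longrightarrow> has_value_A2 (coord2 + inverse coord2) v (v $ 2 + inverse (v $ 2))"
  by (intro has_value_A2_add has_value_A2_inverse has_value_A2_coord2)

lemma add_inverse_eq: "a \<noteq> 0 \<Longrightarrow> a + inverse a = (a\<^sup>2 + 1) / a" for a :: "'a :: field"
  by (simp add: add_divide_distrib power2_eq_square inverse_eq_divide)

lemma coord1_nonzero: "coord1 \<noteq> 0" and coord2_nonzero: "coord2 \<noteq> 0"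
  by (simp_all add: coord1_def coord2_def Zero_fract_def eq_fract)

text \<open>On the chart where the third coordinate is nonzero, the two affine coordinates pull back to
  the sum and the product of the traces.\<close>

lemma traces_in_pullback_field:
  "(coord1 + inverse coord1) + (coord2 + inverse coord2) \<in> pullback_field cover"
  "(coord1 + inverse coord1) * (coord2 + inverse coord2) \<in> pullback_field cover"
proof -
  let ?q = "[:[:0, 1:]:] * [:0, 1:] :: complex poly poly"
  let ?s = sym.subst_lift
  have q: "?q \<noteq> 0" by simp
  have eq: "Fraction_Field.Fract (?s [:[:0, 1:]:]) (?s [:0, 1:]) = (coord1 + inverse coord1) + (coord2 + inverse coord2)"
    "Fraction_Field.Fract (?s [:[:[:0, 1:]:]:]) (?s [:0, 1:]) = (coord1 + inverse coord1) * (coord2 + inverse coord2)"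
  proof -
    show "Fraction_Field.Fract (?s [:[:0, 1:]:]) (?s [:0, 1:]) = (coord1 + inverse coord1) + (coord2 + inverse coord2)"
    proof (rule rational_function_eqI[OF q])
      fix v
      assume "eval2 ?q v \<noteq> 0"
      then have v: "v $ 1 \<noteq> 0" "v $ 2 \<noteq> 0" unfolding eval2_simps by auto
      have "(v $ 1 + inverse (v $ 1)) + (v $ 2 + inverse (v $ 2)) = sym_lift v $ 2 / sym_lift v $ 3"
        using v by (simp add: add_inverse_eq add_frac_eq mult.commute)
      then show "\<exists>c. has_value_A2 (Fraction_Field.Fract (?s [:[:0, 1:]:]) (?s [:0, 1:])) v c \<and>
          has_value_A2 ((coord1 + inverse coord1) + (coord2 + inverse coord2)) v c"
        using has_value_A2_add[OF has_value_A2_coord1_trace[OF v(1)] has_value_A2_coord2_trace[OF v(2)]]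
          has_value_A2_Fract[of "?s [:0, 1:]" v "?s [:[:0, 1:]:]"] v by auto
    qed
    show "Fraction_Field.Fract (?s [:[:[:0, 1:]:]:]) (?s [:0, 1:]) = (coord1 + inverse coord1) * (coord2 + inverse coord2)"
    proof (rule rational_function_eqI[OF q])
      fix v
      assume "eval2 ?q v \<noteq> 0"
      then have v: "v $ 1 \<noteq> 0" "v $ 2 \<noteq> 0" unfolding eval2_simps by auto
      have "(v $ 1 + inverse (v $ 1)) * (v $ 2 + inverse (v $ 2)) = sym_lift v $ 1 / sym_lift v $ 3"
        using v by (simp add: add_inverse_eq)
      then show "\<exists>c. has_value_A2 (Fraction_Field.Fract (?s [:[:[:0, 1:]:]:]) (?s [:0, 1:])) v c \<and>
          has_value_A2 ((coord1 + inverse coord1) * (coord2 + inverse coord2)) v c"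
        using has_value_A2_mult[OF has_value_A2_coord1_trace[OF v(1)] has_value_A2_coord2_trace[OF v(2)]]
          has_value_A2_Fract[of "?s [:0, 1:]" v "?s [:[:[:0, 1:]:]:]"] v by auto
    qed
  qed
  show "(coord1 + inverse coord1) + (coord2 + inverse coord2) \<in> pullback_field cover"
    "(coord1 + inverse coord1) * (coord2 + inverse coord2) \<in> pullback_field cover"
    unfolding eq[symmetric]
    by (rule sym.pullback_fieldI[OF surj_cover], rule homogeneous_variables, rule homogeneous_variables, simp)+
qed


section \<open>Symmetries of the covering\<close>

text \<open>Invariance is expressed through values because a birational \<open>\<tau>\<close> such as \<open>invert1\<close> is not
  defined everywhere; the polynomial \<open>q\<close> discards the bad points, where HOL's \<open>inverse 0 = 0\<close> gives
  a meaningless image.\<close>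

definition invariant :: "(A2 \<Rightarrow> A2) \<Rightarrow> complex poly poly fract \<Rightarrow> bool" where
  "invariant \<tau> b \<longleftrightarrow>
    (\<exists>q. q \<noteq> 0 \<and> (\<forall>v. eval2 q v \<noteq> 0 \<longrightarrow> (\<exists>c. has_value_A2 b v c \<and> has_value_A2 b (\<tau> v) c)))"

lemma invariantI:
  assumes "q \<noteq> 0" "\<And>v. eval2 q v \<noteq> 0 \<Longrightarrow> \<exists>c. has_value_A2 b v c \<and> has_value_A2 b (\<tau> v) c"
  shows "invariant \<tau> b"
  using assms unfolding invariant_def by blast

text \<open>This refutes invariance: a polynomial \<open>r\<close> can be chosen whose nonvanishing forces the values at
  \<open>v\<close> and \<open>\<tau> v\<close> to differ.\<close>

lemma invariant_generic_point:
  assumes "invariant \<tau> b" "r \<noteq> 0"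
  obtains v c where "eval2 r v \<noteq> 0" "has_value_A2 b v c" "has_value_A2 b (\<tau> v) c"
proof -
  obtain q where q: "q \<noteq> 0"
    "\<forall>v. eval2 q v \<noteq> 0 \<longrightarrow> (\<exists>c. has_value_A2 b v c \<and> has_value_A2 b (\<tau> v) c)"
    using assms(1) unfolding invariant_def by blast
  then have "q * r \<noteq> 0" using assms(2) by simp
  then obtain v where "eval2 (q * r) v \<noteq> 0" using eval2_eq_0_imp by blast
  then show ?thesis using q(2) that by auto
qed

lemma invariant_add_mult:
  assumes "invariant \<tau> a" "invariant \<tau> b"
  shows "invariant \<tau> (a + b)" "invariant \<tau> (a * b)"
proof -
  obtain p q where
    p: "p \<noteq> 0" "\<And>v. eval2 p v \<noteq> 0 \<Longrightarrow> \<exists>c. has_value_A2 a v c \<and> has_value_A2 a (\<tau> v) c" and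
    q: "q \<noteq> 0" "\<And>v. eval2 q v \<noteq> 0 \<Longrightarrow> \<exists>c. has_value_A2 b v c \<and> has_value_A2 b (\<tau> v) c"
    using assms unfolding invariant_def by blast
  have "\<exists>c. has_value_A2 (a + b) v c \<and> has_value_A2 (a + b) (\<tau> v) c"
    "\<exists>c. has_value_A2 (a * b) v c \<and> has_value_A2 (a * b) (\<tau> v) c" if "eval2 (p * q) v \<noteq> 0" for v
    using p(2)[of v] q(2)[of v] that has_value_A2_add has_value_A2_mult by auto blast+
  moreover have "p * q \<noteq> 0" using p(1) q(1) by simp
  ultimately show "invariant \<tau> (a + b)" "invariant \<tau> (a * b)" using invariantI by blast+
qed

lemma invariant_adjoin_quadratic:
  assumes "\<And>a. a \<in> K \<Longrightarrow> invariant \<tau> a" "invariant \<tau> z" "b \<in> adjoin_quadratic K z"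
  shows "invariant \<tau> b"
  using assms unfolding adjoin_quadratic_def by (auto intro!: invariant_add_mult)

lemma invariant_pullback_field:
  assumes r: "r \<noteq> 0" "\<And>v. eval2 r v \<noteq> 0 \<Longrightarrow> \<exists>c. sym_lift (\<tau> v) = c *s sym_lift v"
    and b: "b \<in> pullback_field cover"
  shows "invariant \<tau> b"
proof -
  obtain q where q: "q \<noteq> 0"
    "\<And>v v'. cover v = cover v' \<Longrightarrow> eval2 q v \<noteq> 0 \<Longrightarrow> \<exists>c. has_value_A2 b v c \<and> has_value_A2 b v' c"
    using sym.pullback_field_constant_on_fibres[OF surj_cover b] by metis
  show ?thesis
  proof (rule invariantI)
    show "q * r \<noteq> 0" using q(1) r(1) by simp
    fix v assume v: "eval2 (q * r) v \<noteq> 0"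
    then have "cover v = cover (\<tau> v)"
      using r(2)[of v] cover_eq_iff[OF sym.nonzero, of v "\<tau> v"] by (simp add: sym.map_P2_def)
    then show "\<exists>c. has_value_A2 b v c \<and> has_value_A2 b (\<tau> v) c" using q(2) v by simp
  qed
qed

definition swap :: "A2 \<Rightarrow> A2" where "swap v = vector [v $ 2, v $ 1]"
definition invert1 :: "A2 \<Rightarrow> A2" where "invert1 v = vector [inverse (v $ 1), v $ 2]"
definition invert2 :: "A2 \<Rightarrow> A2" where "invert2 v = vector [v $ 1, inverse (v $ 2)]"

lemma symmetry_nth [simp]:
  "swap v $ 1 = v $ 2" "swap v $ 2 = v $ 1"
  "invert1 v $ 1 = inverse (v $ 1)" "invert1 v $ 2 = v $ 2"
  "invert2 v $ 1 = v $ 1" "invert2 v $ 2 = inverse (v $ 2)"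
  by (simp_all add: swap_def invert1_def invert2_def)

lemma sym_lift_swap: "sym_lift (swap v) = sym_lift v"
  by (simp add: vec3_eq_iff algebra_simps)

lemma sym_lift_invert1:
  fixes v :: A2
  assumes "v $ 1 \<noteq> 0"
  shows "sym_lift (invert1 v) = inverse (v $ 1) ^ 2 *s sym_lift v"
proof -
  obtain a t where a: "v $ 1 = a" and t: "inverse a = t" by blast
  then have "a * t = 1" using assms by auto
  then have at: "t\<^sup>2 * a = t" "t\<^sup>2 * a\<^sup>2 = 1"
    by (simp_all add: power2_eq_square) (metis mult.commute mult.right_neutral mult.assoc)+
  have "t\<^sup>2 * ((a\<^sup>2 + 1) * s) = (t\<^sup>2 * a\<^sup>2) * s + t\<^sup>2 * s"
    "t\<^sup>2 * ((a\<^sup>2 + 1) * r + a * s) = (t\<^sup>2 * a\<^sup>2) * r + t\<^sup>2 * r + (t\<^sup>2 * a) * s"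
    "t\<^sup>2 * (a * r) = (t\<^sup>2 * a) * r" for r s
    by (simp_all add: algebra_simps)
  note eqs = this[unfolded at]
  show ?thesis
    unfolding vec3_eq_iff vector_smult_component sym_lift_nth symmetry_nth a t eqs
    by (simp add: algebra_simps)
qed

lemma sym_lift_invert2:
  fixes v :: A2
  assumes "v $ 2 \<noteq> 0"
  shows "sym_lift (invert2 v) = inverse (v $ 2) ^ 2 *s sym_lift v"
proof -
  have "invert2 v = swap (invert1 (swap v))" by (simp add: vec_eq_iff forall_2)
  then show ?thesis using sym_lift_invert1[of "swap v"] assms by (simp add: sym_lift_swap)
qed

lemma pullback_field_symmetries:
  assumes "b \<in> pullback_field cover"
  shows "invariant swap b" "invariant invert1 b" "invariant invert2 b"
proof -
  show "invariant swap b"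
  proof (rule invariant_pullback_field[OF one_neq_zero _ assms])
    show "\<exists>c. sym_lift (swap v) = c *s sym_lift v" for v
      by (intro exI[of _ 1]) (simp add: vec3_eq_iff algebra_simps)
  qed
  show "invariant invert1 b"
  proof (rule invariant_pullback_field[OF _ _ assms])
    show "\<exists>c. sym_lift (invert1 v) = c *s sym_lift v" if "eval2 [:[:0, 1:]:] v \<noteq> 0" for v
      using that sym_lift_invert1 unfolding eval2_simps by blast
  qed simp
  show "invariant invert2 b"
  proof (rule invariant_pullback_field[OF _ _ assms])
    show "\<exists>c. sym_lift (invert2 v) = c *s sym_lift v" if "eval2 [:0, 1:] v \<noteq> 0" for v
      using that sym_lift_invert2 unfolding eval2_simps by blast
  qed simp
qed

lemma trace1_invert1: "invariant invert1 (coord1 + inverse coord1)"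
proof (rule invariantI[of "[:[:0, 1:]:]"])
  fix v
  assume "eval2 [:[:0, 1:]:] v \<noteq> 0"
  then have "v $ 1 \<noteq> 0" unfolding eval2_simps .
  then show "\<exists>c. has_value_A2 (coord1 + inverse coord1) v c \<and> has_value_A2 (coord1 + inverse coord1) (invert1 v) c"
    using has_value_A2_coord1_trace[of v] has_value_A2_coord1_trace[of "invert1 v"]
    by (auto simp: add.commute)
qed simp

lemma coord1_invert2: "invariant invert2 coord1"
proof (rule invariantI[OF one_neq_zero])
  show "\<exists>c. has_value_A2 coord1 v c \<and> has_value_A2 coord1 (invert2 v) c" for v
    using has_value_A2_coord1[of v] has_value_A2_coord1[of "invert2 v"] by auto
qed

lemma trace1_invert2: "invariant invert2 (coord1 + inverse coord1)"
proof (rule invariantI[of "[:[:0, 1:]:]"])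
  fix v
  assume "eval2 [:[:0, 1:]:] v \<noteq> 0"
  then have "v $ 1 \<noteq> 0" unfolding eval2_simps .
  then show "\<exists>c. has_value_A2 (coord1 + inverse coord1) v c \<and> has_value_A2 (coord1 + inverse coord1) (invert2 v) c"
    using has_value_A2_coord1_trace[of v] has_value_A2_coord1_trace[of "invert2 v"] by auto
qed simp

text \<open>Equal values would force \<open>u = w\<close>, \<open>x\<^sup>2 = 1\<close> and \<open>y\<^sup>2 = 1\<close> respectively. The polynomials \<open>r\<close>
  exclude these together with the zeros of the coordinates.\<close>

lemma not_invariant:
  "\<not> invariant swap (coord1 + inverse coord1)"
  "\<not> invariant invert1 coord1"
  "\<not> invariant invert2 coord2"
proof -
  let ?x = "[:[:0, 1:]:] :: complex poly poly" and ?y = "[:0, 1:] :: complex poly poly"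
  \<comment> \<open>A point at which none of the three polynomials used below vanishes.\<close>
  let ?p = "vector [2, 3] :: A2"
  show "\<not> invariant swap (coord1 + inverse coord1)"
  proof
    let ?r = "?x * ?y * ((?x ^ 2 + 1) * ?y - (?y ^ 2 + 1) * ?x)"
    assume "invariant swap (coord1 + inverse coord1)"
    moreover have "eval2 ?r ?p \<noteq> 0" unfolding eval2_simps by simp
    then have "?r \<noteq> 0" by (metis eval2_simps(1))
    ultimately obtain v c where v: "eval2 ?r v \<noteq> 0" and
      c: "has_value_A2 (coord1 + inverse coord1) v c" "has_value_A2 (coord1 + inverse coord1) (swap v) c"
      by (rule invariant_generic_point)
    from v have nz: "v $ 1 \<noteq> 0" "v $ 2 \<noteq> 0"
      and ne: "(v $ 1 ^ 2 + 1) * v $ 2 - (v $ 2 ^ 2 + 1) * v $ 1 \<noteq> 0"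
      unfolding eval2_simps by auto
    have "v $ 1 + inverse (v $ 1) = v $ 2 + inverse (v $ 2)"
      using has_value_A2_unique[OF c(1) has_value_A2_coord1_trace] nz
        has_value_A2_unique[OF c(2) has_value_A2_coord1_trace] by simp
    then show False using ne nz by (simp add: add_inverse_eq frac_eq_eq)
  qed
  show "\<not> invariant invert1 coord1"
  proof
    let ?r = "?x * (?x ^ 2 - 1)"
    assume "invariant invert1 coord1"
    moreover have "eval2 ?r ?p \<noteq> 0" unfolding eval2_simps by simp
    then have "?r \<noteq> 0" by (metis eval2_simps(1))
    ultimately obtain v c where v: "eval2 ?r v \<noteq> 0" and
      c: "has_value_A2 coord1 v c" "has_value_A2 coord1 (invert1 v) c"
      by (rule invariant_generic_point)
    have "v $ 1 = inverse (v $ 1)"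
      using has_value_A2_unique[OF c(1) has_value_A2_coord1]
        has_value_A2_unique[OF c(2) has_value_A2_coord1] by simp
    moreover from v have "v $ 1 \<noteq> 0" "v $ 1 ^ 2 \<noteq> 1" unfolding eval2_simps by auto
    ultimately show False by (metis power2_eq_square right_inverse)
  qed
  show "\<not> invariant invert2 coord2"
  proof
    let ?r = "?y * (?y ^ 2 - 1)"
    assume "invariant invert2 coord2"
    moreover have "eval2 ?r ?p \<noteq> 0" unfolding eval2_simps by simp
    then have "?r \<noteq> 0" by (metis eval2_simps(1))
    ultimately obtain v c where v: "eval2 ?r v \<noteq> 0" and
      c: "has_value_A2 coord2 v c" "has_value_A2 coord2 (invert2 v) c"
      by (rule invariant_generic_point)
    have "v $ 2 = inverse (v $ 2)"
      using has_value_A2_unique[OF c(1) has_value_A2_coord2]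
        has_value_A2_unique[OF c(2) has_value_A2_coord2] by simp
    moreover from v have "v $ 2 \<noteq> 0" "v $ 2 ^ 2 \<noteq> 1" unfolding eval2_simps by auto
    ultimately show False by (metis power2_eq_square right_inverse)
  qed
qed


section \<open>The degree of the covering\<close>

lemma subfield_with_coordinates_eq_UNIV:
  assumes E: "subfield E ring_of_type_algebra"
    and "\<And>c. Fraction_Field.Fract [:[:c:]:] 1 \<in> E" "coord1 \<in> E" "coord2 \<in> E"
  shows "E = UNIV"
proof -
  have inv: "\<And>a. a \<in> E \<Longrightarrow> inverse a \<in> E" and add: "\<And>a b. a \<in> E \<Longrightarrow> b \<in> E \<Longrightarrow> a + b \<in> E"
    and mult: "\<And>a b. a \<in> E \<Longrightarrow> b \<in> E \<Longrightarrow> a * b \<in> E"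
    using E unfolding subfield_ring_of_type_algebra_iff by blast+
  have 0: "Fraction_Field.Fract 0 1 \<in> E" using assms(2)[of 0] by simp
  have 1: "Fraction_Field.Fract [:p:] 1 \<in> E" for p
  proof (induction p)
    case (pCons a p)
    have "Fraction_Field.Fract [:pCons a p:] 1 =
      Fraction_Field.Fract [:[:a:]:] 1 + coord1 * Fraction_Field.Fract [:p:] 1"
      by (simp add: coord1_def)
    then show ?case using pCons.IH assms add mult by metis
  qed (simp add: 0)
  have 2: "Fraction_Field.Fract p 1 \<in> E" for p
  proof (induction p)
    case (pCons a p)
    have "Fraction_Field.Fract (pCons a p) 1 =
      Fraction_Field.Fract [:a:] 1 + coord2 * Fraction_Field.Fract p 1"
      by (simp add: coord2_def)
    then show ?case using pCons.IH 1 assms(4) add mult by metis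
  qed (simp add: 0)
  have "b \<in> E" for b
  proof (cases b)
    case (Fract g h)
    then have "b = Fraction_Field.Fract g 1 * inverse (Fraction_Field.Fract h 1)" by simp
    then show ?thesis using 2 inv mult by metis
  qed
  then show ?thesis by blast
qed

lemma subfield_pullback_field: "subfield (pullback_field cover) ring_of_type_algebra"
  unfolding subfield_ring_of_type_algebra_iff
proof (intro conjI ballI)
  let ?s = sym.subst_lift
  show "1 \<in> pullback_field cover"
    using sym.const_in_pullback_field[OF surj_cover, of 1] by (simp add: pCons_one One_fract_def)
  fix a assume "a \<in> pullback_field cover"
  then obtain g h d where a: "homogeneous d g" "homogeneous d h" "h \<noteq> 0" "?s h \<noteq> 0"
    "a = Fraction_Field.Fract (?s g) (?s h)"
    by (rule sym.pullback_fieldE[OF surj_cover])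
  show "- a \<in> pullback_field cover"
    using sym.pullback_fieldI[OF surj_cover homogeneous_uminus[OF a(1)] a(2,3)] a(5)
    by (simp add: sym.subst_lift_simps)
  show "inverse a \<in> pullback_field cover"
  proof (cases "g = 0")
    case True
    then have "a = Fraction_Field.Fract [:[:0:]:] 1"
      using a(4,5) sym.subst_lift_simps(5)[of 0] by (simp add: eq_fract)
    then have "inverse a = a" by (simp add: Zero_fract_def[symmetric])
    then show ?thesis using \<open>a \<in> pullback_field cover\<close> by simp
  next
    case False
    then show ?thesis using sym.pullback_fieldI[OF surj_cover a(2,1)] a(5) by simp
  qed
  fix b assume "b \<in> pullback_field cover"
  then obtain g' h' d' where b: "homogeneous d' g'" "homogeneous d' h'" "h' \<noteq> 0" "?s h' \<noteq> 0"
    "b = Fraction_Field.Fract (?s g') (?s h')"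
    by (rule sym.pullback_fieldE[OF surj_cover])
  have hh: "homogeneous (d + d') (h * h')" "h * h' \<noteq> 0"
    using a b by (simp_all add: homogeneous_mult)
  have "homogeneous (d + d') (g * h' + g' * h)"
    using homogeneous_add[OF homogeneous_mult[OF a(1) b(2)]] homogeneous_mult[OF b(1) a(2)]
    by (simp add: add.commute)
  then show "a + b \<in> pullback_field cover"
    using sym.pullback_fieldI[OF surj_cover _ hh] a(4,5) b(4,5) by (force simp: sym.subst_lift_simps)
  show "a * b \<in> pullback_field cover"
    using sym.pullback_fieldI[OF surj_cover homogeneous_mult[OF a(1) b(1)] hh] a(5) b(5)
    by (simp add: sym.subst_lift_simps)
qed

lemma trace_quadratic:
  fixes a :: "'a :: field"
  assumes "a \<noteq> 0"
  shows "a * a = (a + inverse a) * a + (- 1)"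
  using assms by (simp add: algebra_simps)

lemma has_degree_cover: "has_degree cover 8"
proof -
  let ?R = "ring_of_type_algebra :: complex poly poly fract ring"
  interpret R: Ring.field ?R by (rule field_from_type_algebra)
  define K u w where "K = pullback_field cover" and "u = coord1 + inverse coord1"
    and "w = coord2 + inverse coord2"
  define K1 where "K1 = adjoin_quadratic K u"
  define K2 where "K2 = adjoin_quadratic K1 coord1"
  define K3 where "K3 = adjoin_quadratic K2 coord2"
  have closed: "1 \<in> L" "0 \<in> L" "a \<in> L \<Longrightarrow> - a \<in> L"
    if "subfield L ?R" for L a
    using that unfolding subfield_ring_of_type_algebra_iff by (auto) (metis add.right_inverse)
  have sub: "L \<subseteq> adjoin_quadratic L z" "z \<in> adjoin_quadratic L z" if "subfield L ?R" for L z
    unfolding adjoin_quadratic_def using closed[OF that] by force+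
  have K: "subfield K ?R" unfolding K_def by (rule subfield_pullback_field)
  have inv: "invariant swap b" "invariant invert1 b" "invariant invert2 b" if "b \<in> K" for b
    using pullback_field_symmetries that unfolding K_def by blast+
  have inv1: "invariant invert1 b" "invariant invert2 b" if "b \<in> K1" for b
    using invariant_adjoin_quadratic[of K _ u b] that inv trace1_invert1 trace1_invert2
    unfolding K1_def u_def by blast+
  have inv2: "invariant invert2 b" if "b \<in> K2" for b
    using invariant_adjoin_quadratic[of K1 _ coord1 b] that inv1 coord1_invert2
    unfolding K2_def by blast
  have uw: "u + w \<in> K" "u * w \<in> K"
    unfolding K_def u_def w_def by (rule traces_in_pullback_field)+
  have "u \<notin> K" using inv(1) not_invariant(1) unfolding u_def by blast
  moreover have "u * u = (u + w) * u + (- (u * w))" by (simp add: algebra_simps)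
  ultimately have K1: "subfield K1 ?R" "R.dimension 2 K K1"
    unfolding K1_def using quadratic_extension[OF K] uw closed(3)[OF K] by blast+
  have "coord1 \<notin> K1" using inv1(1) not_invariant(2) by blast
  moreover have "u \<in> K1" using sub[OF K] unfolding K1_def by blast
  ultimately have K2: "subfield K2 ?R" "R.dimension 2 K1 K2"
    unfolding K2_def
    using quadratic_extension[OF K1(1) _ trace_quadratic[OF coord1_nonzero, folded u_def]]
      closed(1,3)[OF K1(1)] by blast+
  have "coord2 \<notin> K2" using inv2 not_invariant(3) by blast
  moreover have "w \<in> K1"
  proof -
    have "w = (u + w) + (- 1) * u" by simp
    then show ?thesis unfolding K1_def adjoin_quadratic_def using uw closed[OF K] by blast
  qed
  then have "w \<in> K2" using sub[OF K1(1)] unfolding K2_def by blast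
  ultimately have K3: "subfield K3 ?R" "R.dimension 2 K2 K3"
    unfolding K3_def
    using quadratic_extension[OF K2(1) _ trace_quadratic[OF coord2_nonzero, folded w_def]]
      closed(1,3)[OF K2(1)] by blast+
  have "K \<subseteq> K3" "coord1 \<in> K3" "coord2 \<in> K3"
    using sub[OF K] sub[OF K1(1)] sub[OF K2(1)] unfolding K3_def K2_def K1_def by blast+
  then have "K3 = carrier ?R"
    using subfield_with_coordinates_eq_UNIV[OF K3(1)] sym.const_in_pullback_field[OF surj_cover]
    unfolding K_def by (auto simp: ring_of_type_algebra_def)
  moreover have "R.dimension (2 * 2 * 2) K K3"
    using R.telescopic_base[OF K K2(1) R.telescopic_base[OF K K1(1) K1(2) K2(2)] K3(2)] .
  ultimately show ?thesis using K unfolding has_degree_def K_def by simp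
qed

theorem proposition2p4:
  shows "\<exists>f :: A2 \<Rightarrow> P2.
           morphism_A2_P2 f \<and> surj f \<and> has_degree f 8 \<and> (\<forall>x. finite (f -` {x}))"
  using sym.morphism surj_cover has_degree_cover finite_fibre by blast

end
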